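(* Let the conditional variances $\mathrm{Var}_*$, the matrices $\mathbf{F}$, $\tilde{\mathbf{F}}=(\mathbf{1},\mathbf{F})$, $\bar{\mathbf{F}}$ (each assumed to have full column rank), and the combined forecasts $\hat{y}^{\mathcal{X}}_{Z,T+1}$ be as defined in the context. Then: (1) $\mathrm{Var}_*(\hat{y}^{\mathcal{A}'}_{\mathrm{reg},T+1})\geq \mathrm{Var}_*(\hat{y}^{\mathcal{A}}_{\mathrm{reg},T+1})\geq \mathrm{Var}_*(\hat{y}^{\mathcal{B}}_{\mathrm{reg},T+1})$ and $\mathrm{Var}_*(\hat{y}^{\mathcal{A}}_{\mathrm{cv},T+1})\geq \mathrm{Var}_*(\hat{y}^{\mathcal{B}}_{\mathrm{cv},T+1})$. (2) $\mathrm{Var}_*(\hat{y}^{\mathcal{C}}_{Z,T+1})\leq S\,\mathbf{f}_{T+1}^\top\mathbf{f}_{T+1}$ for each $Z\in\{\mathrm{reg},\mathrm{ma},\mathrm{cv}\}$. (3) $\mathrm{Var}_*(\hat{y}^{\mathcal{D}}_{Z,T+1})\leq \mathbf{f}_{T+1}^\top\mathbf{f}_{T+1}$ for each $Z\in\{\mathrm{reg},\mathrm{ma},\mathrm{cv},\mathrm{pf}\}$. (4) $\mathrm{Var}_*(\hat{y}^{\mathcal{E}}_{\mathrm{eig},T+1})\leq \mathbf{f}_{T+1}^\top\mathbf{f}_{T+1}$.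
   Context: Data and forecasts. $\mathbf{y}=(y_1,\ldots,y_T)^\top$ is observed; $\mathbf{f}_t=(f_{t,1},\ldots,f_{t,S})^\top\in\mathbb{R}^S$ is the vector of $S$ candidate forecasts at time $t=1,\ldots,T+1$; $\mathbf{F}=(\mathbf{f}_1,\ldots,\mathbf{f}_T)^\top$ is the $T\times S$ matrix of candidate forecasts, with columns $\mathbf{f}_{(1)},\ldots,\mathbf{f}_{(S)}$. $\mathbf{f}_t^{[-t]}$ is the vector of candidate forecasts for time $t$ computed without the $t$-th observation and $\bar{\mathbf{F}}=(\mathbf{f}_1^{[-1]},\ldots,\mathbf{f}_T^{[-T]})^\top$ ($T\times S$). $\mathbf{1}$ denotes a vector of ones of the appropriate dimension. Conditional moments. $\mathrm{E}_*$ and $\mathrm{Var}_*$ denote expectation and variance conditional on the candidate forecasts $\mathbf{f}_1,\ldots,\mathbf{f}_{T+1}$; these (and $\bar{\mathbf{F}}$) are treated as fixed, so that randomness comes solely from $\mathbf{y}$. The errors $y_t-\mathrm{E}_*(y_t)$ are independent with mean zero and variance $\sigma^2$, so $\mathrm{Var}_*(\mathbf{y})=\sigma^2\mathbf{I}_T$. Weight spaces. $\mathbb{W}^{\mathcal{A}}=\mathbb{R}^S$; $\mathbb{W}^{\mathcal{B}}=\{\mathbf{w}:\mathbf{w}^\top\mathbf{1}=1\}$; $\mathbb{W}^{\mathcal{C}}=[0,1]^S$; $\mathbb{W}^{\mathcal{D}}=\{\mathbf{w}\in[0,1]^S:\mathbf{1}^\top\mathbf{w}=1\}$; $\mathbb{W}^{\mathcal{E}}=\{\mathbf{w}\in\mathbb{R}^S:\mathbf{w}^\top\mathbf{w}=1\}$.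 Weights. For $\mathcal{X}\in\{\mathcal{A},\mathcal{B},\mathcal{C},\mathcal{D}\}$: - $\hat{\mathbf{w}}^{\mathcal{X}}_{\mathrm{reg}}$ minimizes $\|\mathbf{y}-\mathbf{F}\mathbf{w}\|^2$ over $\mathbf{w}\in\mathbb{W}^{\mathcal{X}}$. In particular $\hat{\mathbf{w}}^{\mathcal{A}}_{\mathrm{reg}}=(\mathbf{F}^\top\mathbf{F})^{-1}\mathbf{F}^\top\mathbf{y}$ and $\hat{\mathbf{w}}^{\mathcal{B}}_{\mathrm{reg}}=\hat{\mathbf{w}}^{\mathcal{A}}_{\mathrm{reg}}-\hat{\rho}_0(\mathbf{F}^\top\mathbf{F})^{-1}\mathbf{1}$ with $\hat{\rho}_0=(\mathbf{1}^\top\hat{\mathbf{w}}^{\mathcal{A}}_{\mathrm{reg}}-1)/\{\mathbf{1}^\top(\mathbf{F}^\top\mathbf{F})^{-1}\mathbf{1}\}$. - $(\hat{\delta}_0,\hat{\mathbf{w}}^{\mathcal{A}'\top}_{\mathrm{reg}})^\top=(\tilde{\mathbf{F}}^\top\tilde{\mathbf{F}})^{-1}\tilde{\mathbf{F}}^\top\mathbf{y}$ with $\tilde{\mathbf{F}}=(\mathbf{1},\mathbf{F})$ is the least squares estimator in the regression with intercept $y_t=\delta_0+\mathbf{f}_t^\top\mathbf{w}+\epsilon_t$. - $\hat{\mathbf{w}}^{\mathcal{X}}_{\mathrm{cv}}$ minimizes $\|\mathbf{y}-\bar{\mathbf{F}}\mathbf{w}\|^2$ over $\mathbb{W}^{\mathcal{X}}$.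 In particular $\hat{\mathbf{w}}^{\mathcal{A}}_{\mathrm{cv}}=(\bar{\mathbf{F}}^\top\bar{\mathbf{F}})^{-1}\bar{\mathbf{F}}^\top\mathbf{y}$ and $\hat{\mathbf{w}}^{\mathcal{B}}_{\mathrm{cv}}=\hat{\mathbf{w}}^{\mathcal{A}}_{\mathrm{cv}}-\bar{\rho}_0(\bar{\mathbf{F}}^\top\bar{\mathbf{F}})^{-1}\mathbf{1}$ with $\bar{\rho}_0=(\mathbf{1}^\top\hat{\mathbf{w}}^{\mathcal{A}}_{\mathrm{cv}}-1)/\{\mathbf{1}^\top(\bar{\mathbf{F}}^\top\bar{\mathbf{F}})^{-1}\mathbf{1}\}$. - $\hat{\mathbf{w}}^{\mathcal{X}}_{\mathrm{ma}}$ minimizes the generalized Mallows criterion $\mathcal{D}(\mathbf{w})=\mathbf{w}^\top\mathbf{F}^\top\mathbf{F}\mathbf{w}+2\mathbf{w}^\top\boldsymbol{\psi}+\mathbf{y}^\top\mathbf{y}$ over $\mathbb{W}^{\mathcal{X}}$, where $\boldsymbol{\psi}=\hat{\sigma}^2\mathbf{k}-\mathbf{F}^\top\mathbf{y}$ (Mallows) or $\boldsymbol{\psi}=\hat{\sigma}^2\mathbf{k}-\boldsymbol{\phi}-\mathbf{F}^\top\mathbf{y}$ (Kullback–Leibler). Here $\mathbf{f}_{(s)}=\mathbf{P}_s\mathbf{y}$ with $\mathbf{P}_s$ the projection matrix of the $s$-th candidate linear model, $\mathbf{k}=(\mathrm{tr}(\mathbf{P}_1),\ldots,\mathrm{tr}(\mathbf{P}_S))^\top$,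 $\hat{\sigma}^2$ is an estimator of the error variance, and $\boldsymbol{\phi}=(\mathbf{f}_{(1)},\ldots,\mathbf{f}_{(S)})^\top\partial\hat{\sigma}^2/\partial\mathbf{y}$. - $\hat{\mathbf{w}}^{\mathcal{D}}_{\mathrm{pf}}\in\mathbb{W}^{\mathcal{D}}$ is an individual performance-based weight vector, with $s$-th component either $a^{q_s}(n-q_s)^b(\hat{\sigma}_s^2)^c/\sum_{j=1}^S a^{q_j}(n-q_j)^b(\hat{\sigma}_j^2)^c$, where $n$ is the sample size, $a>0$, $b\geq0$, $c\leq0$, $q_j\geq0$ and $\hat{\sigma}_s^2$ is the maximum likelihood estimator of the variance of the $s$-th candidate forecast, or $L_s^{-1}/\sum_{j=1}^S L_j^{-1}$, where $L_s$ is a (positive) loss of the $s$-th forecast. - $\hat{\mathbf{w}}^{\mathcal{E}}_{\mathrm{eig}}\in\mathbb{W}^{\mathcal{E}}$ is a unit-norm eigenvector belonging to the smallest eigenvalue of $T^{-1}\sum_{t=1}^T(y_t\mathbf{1}-\mathbf{f}_t)(y_t\mathbf{1}-\mathbf{f}_t)^\top$. Combined forecasts. $\hat{y}^{\mathcal{X}}_{Z,T+1}=\mathbf{f}_{T+1}^\top\hat{\mathbf{w}}^{\mathcal{X}}_{Z}$, except that $\hat{y}^{\mathcal{A}'}_{\mathrm{reg},T+1}=\hat{\delta}_0+\mathbf{f}_{T+1}^\top\hat{\mathbf{w}}^{\mathcal{A}'}_{\mathrm{reg}}$. *)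

theory Defs
  imports "HOL-Probability.Probability"
begin

text \<open>
  The candidate forecasts are conditioned upon and treated as fixed, so they are constants: a matrix
  \<open>F\<close> whose row \<open>F $ t\<close> is the vector of forecasts for time \<open>t\<close>, a second such matrix for the
  forecasts computed without the observation to be predicted, and a vector \<open>f\<close> for the time after
  the sample. The measure \<open>M\<close> is the conditional law given the forecasts, so that plain expectation
  and variance under \<open>M\<close> are the conditional moments. Every weight is a function of the data vector
  \<open>v\<close>, which is later replaced by the random vector \<open>y\<close>.
\<close>

definition observations :: "'w measure \<Rightarrow> ('w \<Rightarrow> real ^ 't::finite) \<Rightarrow> real \<Rightarrow> bool" where
  "observations M y \<sigma> \<longleftrightarrow>
     prob_space M \<and> y \<in> borel_measurable M \<and>
     (\<forall>t. integrable M (\<lambda>\<omega>. y \<omega> $ t) \<and> integrable M (\<lambda>\<omega>. (y \<omega> $ t)\<^sup>2)) \<and>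
     (let \<epsilon> = (\<lambda>t \<omega>. y \<omega> $ t - integral\<^sup>L M (\<lambda>\<omega>. y \<omega> $ t)) in
        prob_space.indep_vars M (\<lambda>_. borel) \<epsilon> UNIV \<and>
        (\<forall>t. integral\<^sup>L M (\<epsilon> t) = 0 \<and> prob_space.variance M (\<epsilon> t) = \<sigma>\<^sup>2))"

definition forecast_variance :: "'w measure \<Rightarrow> ('w \<Rightarrow> real ^ 't) \<Rightarrow> (real ^ 't \<Rightarrow> real) \<Rightarrow> real" where
  "forecast_variance M y g = prob_space.variance M (\<lambda>\<omega>. g (y \<omega>))"

datatype weight_kind = KA | KB | KC | KD | KE

primrec weight_space :: "weight_kind \<Rightarrow> (real ^ 's::finite) set" where
  "weight_space KA = UNIV"
| "weight_space KB = {w. w \<bullet> 1 = 1}"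
| "weight_space KC = {w. \<forall>i. w $ i \<in> {0..1}}"
| "weight_space KD = {w. (\<forall>i. w $ i \<in> {0..1}) \<and> 1 \<bullet> w = 1}"
| "weight_space KE = {w. w \<bullet> w = 1}"

text \<open>Applied to \<open>F\<close> this gives the regression weights, applied to the leave-one-out forecasts the
  cross-validation weights. The minimizer is unique when the matrix has full column rank.\<close>

definition ls_weights :: "weight_kind \<Rightarrow> real ^ 's ^ 't \<Rightarrow> real ^ 't \<Rightarrow> real ^ 's" where
  "ls_weights X F v = arg_min_on (\<lambda>w. (norm (v - F *v w))\<^sup>2) (weight_space X)"

text \<open>The column indexed by \<open>None\<close> is the intercept.\<close>

definition with_intercept :: "real ^ 's ^ 't \<Rightarrow> real ^ 's option ^ 't" where
  "with_intercept F = (\<chi> t i. case i of None \<Rightarrow> 1 | Some s \<Rightarrow> F $ t $ s)"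

definition intercept_coeffs :: "real ^ 's ^ 't \<Rightarrow> real ^ 't \<Rightarrow> real ^ 's option" where
  "intercept_coeffs F v =
     (let G = with_intercept F in matrix_inv (transpose G ** G) *v (transpose G *v v))"

definition intercept_forecast :: "real ^ 's ^ 't \<Rightarrow> real ^ 's \<Rightarrow> real ^ 't \<Rightarrow> real" where
  "intercept_forecast F f v =
     intercept_coeffs F v $ None + f \<bullet> (\<chi> s. intercept_coeffs F v $ Some s)"

definition mallows_criterion ::
    "real ^ 's ^ 't \<Rightarrow> real ^ 's \<Rightarrow> real ^ 't \<Rightarrow> real ^ 's \<Rightarrow> real" where
  "mallows_criterion F \<psi> v w = w \<bullet> ((transpose F ** F) *v w) + 2 * (w \<bullet> \<psi>) + v \<bullet> v"

definition ma_weights ::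
    "weight_kind \<Rightarrow> real ^ 's ^ 't \<Rightarrow> (real ^ 't \<Rightarrow> real ^ 's) \<Rightarrow> real ^ 't \<Rightarrow> real ^ 's" where
  "ma_weights X F \<psi> v = arg_min_on (mallows_criterion F (\<psi> v) v) (weight_space X)"

text \<open>\<open>P\<close> is the matrix of the orthogonal projection onto the span of the regressors \<open>B\<close>.\<close>

definition projection_matrix :: "(real ^ 't) set \<Rightarrow> real ^ 't ^ 't \<Rightarrow> bool" where
  "projection_matrix B P \<longleftrightarrow> (\<forall>v. P *v v \<in> span B \<and> (\<forall>b\<in>B. b \<bullet> (v - P *v v) = 0))"

definition gradient :: "(real ^ 't \<Rightarrow> real) \<Rightarrow> real ^ 't \<Rightarrow> real ^ 't" where
  "gradient h v = (\<chi> t. frechet_derivative h (at v) (axis t 1))"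

definition mallows_psi ::
    "real ^ 's ^ 't \<Rightarrow> ('s \<Rightarrow> real ^ 't ^ 't) \<Rightarrow> (real ^ 't \<Rightarrow> real) \<Rightarrow> real ^ 't \<Rightarrow> real ^ 's" where
  "mallows_psi F P s2 v = s2 v *\<^sub>R (\<chi> s. trace (P s)) - transpose F *v v"

definition kl_psi ::
    "real ^ 's ^ 't \<Rightarrow> ('s \<Rightarrow> real ^ 't ^ 't) \<Rightarrow> (real ^ 't \<Rightarrow> real) \<Rightarrow> real ^ 't \<Rightarrow> real ^ 's" where
  "kl_psi F P s2 v =
     s2 v *\<^sub>R (\<chi> s. trace (P s)) - transpose F *v gradient s2 v - transpose F *v v"

text \<open>
  The forecasts are fixed at the values \<open>P s *v y0\<close> that the candidate linear models with regressors
  \<open>B s\<close> produce from a realization \<open>y0\<close> of the data. Asking for \<open>column s F = P s *v y \<omega>\<close> for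
  almost all \<open>\<omega>\<close> instead would imply the condition below, but would contradict the full rank of
  the constant matrix \<open>F\<close> as soon as the error variance is positive.
\<close>

definition ma_linear_term ::
    "'w measure \<Rightarrow> ('w \<Rightarrow> real ^ 't) \<Rightarrow> real ^ 's ^ 't \<Rightarrow> (real ^ 't \<Rightarrow> real ^ 's) \<Rightarrow> bool" where
  "ma_linear_term M y F \<psi> \<longleftrightarrow>
     (\<exists>B P y0 s2.
        (\<forall>s. projection_matrix (B s) (P s) \<and> column s F = P s *v y0) \<and>
        s2 \<in> borel_measurable borel \<and>
        (\<psi> = mallows_psi F P s2 \<or>
         \<psi> = kl_psi F P s2 \<and> (AE \<omega> in M. s2 differentiable (at (y \<omega>)))))"

text \<open>A parameter is a pair of a nuisance part and a positive variance. The likelihood of the data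
  is an argument, as no particular distribution of the forecast errors is prescribed.\<close>

definition variance_mle ::
    "('p \<times> real) set \<Rightarrow> ('p \<times> real \<Rightarrow> real ^ 't \<Rightarrow> real) \<Rightarrow> real ^ 't \<Rightarrow> real \<Rightarrow> bool" where
  "variance_mle \<Theta> lik v s2 \<longleftrightarrow>
     \<Theta> \<subseteq> UNIV \<times> {0<..} \<and> (\<exists>\<beta>. is_arg_max (\<lambda>\<theta>. lik \<theta> v) (\<lambda>\<theta>. \<theta> \<in> \<Theta>) (\<beta>, s2))"

text \<open>Unlike \<open>0 powr 0\<close>, the power of a nonnegative real with exponent 0 is 1 here.\<close>

definition rpower :: "real \<Rightarrow> real \<Rightarrow> real" where
  "rpower x b = (if b = 0 then 1 else x powr b)"

definition pf_score :: "real \<Rightarrow> real \<Rightarrow> real \<Rightarrow> nat \<Rightarrow> real \<Rightarrow> real \<Rightarrow> real" where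
  "pf_score a b c n q s2 = a powr q * rpower (real n - q) b * s2 powr c"

definition normalized :: "('s::finite \<Rightarrow> real) \<Rightarrow> real ^ 's" where
  "normalized g = (\<chi> s. g s / (\<Sum>j\<in>UNIV. g j))"

text \<open>The conditions \<open>q s \<le> n\<close> and a nonzero denominator only make the quotient meaningful.\<close>

definition pf_score_weights ::
    "'w measure \<Rightarrow> ('w \<Rightarrow> real ^ 't) \<Rightarrow> ('s::finite \<Rightarrow> ('p \<times> real) set) \<Rightarrow>
     ('s \<Rightarrow> 'p \<times> real \<Rightarrow> real ^ 't \<Rightarrow> real) \<Rightarrow> (real ^ 't \<Rightarrow> real ^ 's) \<Rightarrow> bool" where
  "pf_score_weights M y \<Theta> lik w \<longleftrightarrow>
     (\<exists>a b c n q s2.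
        a > 0 \<and> b \<ge> 0 \<and> c \<le> 0 \<and> (\<forall>s. 0 \<le> q s \<and> q s \<le> real n) \<and>
        (\<forall>s. s2 s \<in> borel_measurable borel) \<and>
        (AE \<omega> in M. \<forall>s. variance_mle (\<Theta> s) (lik s) (y \<omega>) (s2 s (y \<omega>))) \<and>
        (AE \<omega> in M. (\<Sum>j\<in>UNIV. pf_score a b c n (q j) (s2 j (y \<omega>))) \<noteq> 0) \<and>
        w = (\<lambda>v. normalized (\<lambda>s. pf_score a b c n (q s) (s2 s v))))"

definition pf_loss_weights ::
    "'w measure \<Rightarrow> ('w \<Rightarrow> real ^ 't) \<Rightarrow> (real ^ 't \<Rightarrow> real ^ 's::finite) \<Rightarrow> bool" where
  "pf_loss_weights M y w \<longleftrightarrow>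
     (\<exists>L. (\<forall>s. L s \<in> borel_measurable borel) \<and> (AE \<omega> in M. \<forall>s. L s (y \<omega>) > 0) \<and>
          w = (\<lambda>v. normalized (\<lambda>s. inverse (L s v))))"

definition error_matrix :: "real ^ 's ^ 't \<Rightarrow> real ^ 't \<Rightarrow> real ^ 's ^ 's" where
  "error_matrix F v =
     (1 / real CARD('t)) *\<^sub>R
       (\<Sum>t\<in>UNIV. let e = v $ t *\<^sub>R 1 - F $ t in \<chi> i j. e $ i * e $ j)"

definition eigenvector :: "real ^ 's ^ 's \<Rightarrow> real \<Rightarrow> real ^ 's \<Rightarrow> bool" where
  "eigenvector A l u \<longleftrightarrow> u \<noteq> 0 \<and> A *v u = l *\<^sub>R u"

definition smallest_eigenvalue :: "real ^ 's ^ 's \<Rightarrow> real \<Rightarrow> bool" where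
  "smallest_eigenvalue A l \<longleftrightarrow>
     (\<exists>u. eigenvector A l u) \<and> (\<forall>m. (\<exists>u. eigenvector A m u) \<longrightarrow> l \<le> m)"

text \<open>The eigenvector is determined at best up to sign, hence a predicate on measurable choices.\<close>

definition eig_weights ::
    "'w measure \<Rightarrow> ('w \<Rightarrow> real ^ 't) \<Rightarrow> real ^ 's ^ 't \<Rightarrow> (real ^ 't \<Rightarrow> real ^ 's) \<Rightarrow> bool" where
  "eig_weights M y F w \<longleftrightarrow>
     w \<in> borel_measurable borel \<and>
     (AE \<omega> in M. w (y \<omega>) \<in> weight_space KE \<and>
        (\<exists>l. smallest_eigenvalue (error_matrix F (y \<omega>)) l \<and>
             eigenvector (error_matrix F (y \<omega>)) l (w (y \<omega>))))"

end

theory Submission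
  imports Defs
begin

text \<open>
  The proposition rests on two unrelated ideas.

  The first part is about linear forecasts. Without constraint, with an intercept, or with weights
  summing to one, the combined forecast is an affine function \<open>c + a \<bullet> v\<close> of the data, and since the
  errors are uncorrelated with common variance its variance is \<open>\<sigma>\<^sup>2 * (a \<bullet> a)\<close>
  (lemma \<open>forecast_variance_affine\<close>). So only the lengths of the vectors \<open>a\<close> are to be compared.
  For least squares with the matrix \<open>G\<close> and the forecast \<open>g \<bullet> w\<close> this vector is the shortest
  solution of \<open>transpose G *v a = g\<close>, the one in the range of \<open>G\<close> (\<open>dual_vector\<close> below). The
  vector of the regression with intercept solves the equations for \<open>F\<close> and one more, hence it is
  not shorter (\<open>dual_vector_le_intercept\<close>). Imposing that the weights sum to one
  replaces \<open>a\<close> by its component orthogonal to the dual vector of \<open>1\<close>, so that it is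
  not longer (\<open>sum_constrained_variance_le\<close>).

  The remaining parts hold because the weights are bounded, however they depend on the data. If they
  satisfy \<open>w \<bullet> w \<le> C\<close>, the forecast satisfies
  \<open>(f \<bullet> w)\<^sup>2 \<le> C * (f \<bullet> f)\<close> by the Cauchy-Schwarz inequality, and a variance is
  at most the bound of the square (\<open>forecast_variance_le_of_weight_bound\<close>). Here
  \<open>C\<close> is the number of forecasts on the unit cube, and 1 on the simplex and on the unit
  sphere. For the weights defined by minimization this needs that a minimizer exists, which follows
  from compactness.
\<close>

section \<open>Variance bounds from bounded weights\<close>

text \<open>The function \<open>X\<close> is arbitrary because it will involve minimizers chosen by a choice operator,
  whose dependence on the data is not obviously measurable. If \<open>X\<close> is not integrable, its
  expectation has the default value 0, and \<open>variance X\<close> becomes the integral of \<open>X\<^sup>2\<close>, which is at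
  most \<open>B\<close> or again 0 by default.\<close>

lemma (in prob_space) variance_le_of_AE_square_le:
  fixes X :: "'a \<Rightarrow> real"
  assumes bound: "AE \<omega> in M. (X \<omega>)\<^sup>2 \<le> B"
  shows "variance X \<le> B"
proof -
  have "AE \<omega> in M. 0 \<le> B"
    using bound by eventually_elim (meson order_trans zero_le_power2)
  then have "B \<ge> 0" by simp
  have mean_square: "expectation (\<lambda>\<omega>. (X \<omega>)\<^sup>2) \<le> B"
  proof (cases "integrable M (\<lambda>\<omega>. (X \<omega>)\<^sup>2)")
    case True
    then have "expectation (\<lambda>\<omega>. (X \<omega>)\<^sup>2) \<le> expectation (\<lambda>\<omega>. B)"
      using bound by (intro integral_mono_AE) auto
    then show ?thesis by (simp add: prob_space)
  next
    case False
    then show ?thesis using \<open>B \<ge> 0\<close> by (simp add: not_integrable_integral_eq)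
  qed
  show ?thesis
  proof (cases "integrable M X")
    case True
    then have "integrable M (\<lambda>\<omega>. (X \<omega>)\<^sup>2)"
      using bound by (intro integrable_const_bound[where B = B]) auto
    then have "variance X = expectation (\<lambda>\<omega>. (X \<omega>)\<^sup>2) - (expectation X)\<^sup>2"
      using True by (intro variance_eq)
    then show ?thesis using mean_square by (smt (verit) zero_le_power2)
  next
    case False
    then show ?thesis using mean_square by (simp add: not_integrable_integral_eq)
  qed
qed

lemma forecast_variance_le_of_weight_bound:
  fixes f :: "real ^ 's::finite"
  assumes "prob_space M" and bound: "AE \<omega> in M. w (y \<omega>) \<bullet> w (y \<omega>) \<le> C"
  shows "forecast_variance M y (\<lambda>v. f \<bullet> w v) \<le> C * (f \<bullet> f)"
proof -
  interpret prob_space M by fact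
  have "AE \<omega> in M. (f \<bullet> w (y \<omega>))\<^sup>2 \<le> C * (f \<bullet> f)"
    using bound
  proof eventually_elim
    case (elim \<omega>)
    have "(f \<bullet> w (y \<omega>))\<^sup>2 \<le> (f \<bullet> f) * (w (y \<omega>) \<bullet> w (y \<omega>))"
      by (rule Cauchy_Schwarz_ineq)
    also have "\<dots> \<le> (f \<bullet> f) * C"
      using elim by (intro mult_left_mono) auto
    finally show ?case by (simp add: mult.commute)
  qed
  then show ?thesis
    unfolding forecast_variance_def by (rule variance_le_of_AE_square_le)
qed

lemma unit_cube_norm_le:
  fixes w :: "real ^ 's::finite"
  assumes "w \<in> weight_space KC"
  shows "w \<bullet> w \<le> real CARD('s)"
proof -
  have "w $ i * w $ i \<le> 1" for i
    using assms by (auto intro: mult_le_one)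
  then have "(\<Sum>i\<in>UNIV. w $ i * w $ i) \<le> (\<Sum>i\<in>(UNIV::'s set). 1)"
    by (rule sum_mono)
  then show ?thesis by (simp add: inner_vec_def)
qed

lemma simplex_norm_le:
  fixes w :: "real ^ 's::finite"
  assumes "w \<in> weight_space KD"
  shows "w \<bullet> w \<le> 1"
proof -
  have "w $ i * w $ i \<le> w $ i" for i
    using assms by (auto intro: mult_left_le)
  then have "(\<Sum>i\<in>UNIV. w $ i * w $ i) \<le> (\<Sum>i\<in>UNIV. w $ i)"
    by (rule sum_mono)
  then show ?thesis using assms by (simp add: inner_vec_def)
qed

lemma compact_unit_cube: "compact (weight_space KC :: (real ^ 's::finite) set)"
proof -
  have "weight_space KC = cbox (0 :: real ^ 's) 1"
    by (auto simp: mem_box_cart)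
  then show ?thesis by (metis compact_cbox)
qed

lemma simplex_eq: "weight_space KD = weight_space KC \<inter> {w. 1 \<bullet> w = 1}"
  by auto

lemma compact_simplex: "compact (weight_space KD :: (real ^ 's::finite) set)"
  unfolding simplex_eq by (intro compact_Int_closed compact_unit_cube closed_hyperplane)

lemma axis_in_simplex: "axis i 1 \<in> (weight_space KD :: (real ^ 's::finite) set)"
  by (auto simp: axis_def inner_vec_def)

lemma arg_min_on_in_compact:
  fixes h :: "'a::topological_space \<Rightarrow> real"
  assumes "compact S" "S \<noteq> {}" "continuous_on S h"
  shows "arg_min_on h S \<in> S"
proof -
  obtain x where "x \<in> S" "\<And>z. z \<in> S \<Longrightarrow> h x \<le> h z"
    using continuous_attains_inf[OF assms] by blast
  then show ?thesis
    unfolding arg_min_on_def by (intro arg_minI[where Q = "\<lambda>x. x \<in> S"]) (auto simp: not_less)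
qed

lemma ls_weights_in_weight_space:
  assumes "compact (weight_space X :: (real ^ 's::finite) set)" "weight_space X \<noteq> ({} :: (real ^ 's) set)"
  shows "ls_weights X (F :: real ^ 's ^ 't::finite) v \<in> weight_space X"
  unfolding ls_weights_def using assms
  by (intro arg_min_on_in_compact continuous_intros matrix_vector_mult_linear_continuous_on)

lemma ma_weights_in_weight_space:
  assumes "compact (weight_space X :: (real ^ 's::finite) set)" "weight_space X \<noteq> ({} :: (real ^ 's) set)"
  shows "ma_weights X (F :: real ^ 's ^ 't::finite) \<psi> v \<in> weight_space X"
  unfolding ma_weights_def mallows_criterion_def using assms
  by (intro arg_min_on_in_compact continuous_intros matrix_vector_mult_linear_continuous_on)

lemma normalized_in_simplex:
  fixes g :: "'s::finite \<Rightarrow> real"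
  assumes nonneg: "\<And>s. g s \<ge> 0" and "(\<Sum>j\<in>UNIV. g j) \<noteq> 0"
  shows "normalized g \<in> weight_space KD"
proof -
  have pos: "(\<Sum>j\<in>UNIV. g j) > 0"
    using assms by (simp add: order_less_le sum_nonneg)
  have "g s \<le> (\<Sum>j\<in>UNIV. g j)" for s
    using nonneg by (intro member_le_sum) auto
  then show ?thesis
    using pos nonneg by (auto simp: normalized_def inner_vec_def simp flip: sum_divide_distrib)
qed

lemma pf_weights_in_simplex:
  fixes w :: "real ^ 't::finite \<Rightarrow> real ^ 's::finite"
  assumes "pf_score_weights M y \<Theta> lik w \<or> pf_loss_weights M y w"
  shows "AE \<omega> in M. w (y \<omega>) \<in> weight_space KD"
  using assms
proof
  assume "pf_score_weights M y \<Theta> lik w"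
  then obtain a b c n q s2 where
    nonzero: "AE \<omega> in M. (\<Sum>j\<in>UNIV. pf_score a b c n (q j) (s2 j (y \<omega>))) \<noteq> 0" and
    w: "w = (\<lambda>v. normalized (\<lambda>s. pf_score a b c n (q s) (s2 s v)))"
    unfolding pf_score_weights_def by blast
  have "pf_score a b c n (q s) (s2 s v) \<ge> 0" for s v
    by (simp add: pf_score_def rpower_def)
  with nonzero show ?thesis
    unfolding w by (auto elim!: eventually_mono intro!: normalized_in_simplex simp del: weight_space.simps)
next
  assume "pf_loss_weights M y w"
  then obtain L where
    pos: "AE \<omega> in M. \<forall>s. L s (y \<omega>) > 0" and w: "w = (\<lambda>v. normalized (\<lambda>s. inverse (L s v)))"
    unfolding pf_loss_weights_def by blast
  from pos show ?thesis
  proof eventually_elim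
    case (elim \<omega>)
    then have "(\<Sum>s\<in>UNIV. inverse (L s (y \<omega>))) > 0"
      by (intro sum_pos) auto
    with elim show ?case
      unfolding w by (intro normalized_in_simplex) (auto intro: less_imp_le)
  qed
qed

section \<open>Variance of affine forecasts\<close>

lemma forecast_variance_affine:
  fixes y :: "'w \<Rightarrow> real ^ 't::finite"
  assumes "observations M y \<sigma>"
  shows "forecast_variance M y (\<lambda>v. c + a \<bullet> v) = \<sigma>\<^sup>2 * (a \<bullet> a)"
proof -
  interpret prob_space M using assms by (simp add: observations_def)
  define \<epsilon> where "\<epsilon> = (\<lambda>t \<omega>. y \<omega> $ t - expectation (\<lambda>\<omega>. y \<omega> $ t))"
  have int_y: "integrable M (\<lambda>\<omega>. y \<omega> $ t)" and int_y2: "integrable M (\<lambda>\<omega>. (y \<omega> $ t)\<^sup>2)" for t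
    using assms by (auto simp: observations_def)
  have indep: "indep_vars (\<lambda>_. borel) \<epsilon> UNIV" and mean: "expectation (\<epsilon> t) = 0"
    and var: "variance (\<epsilon> t) = \<sigma>\<^sup>2" for t
    using assms unfolding observations_def Let_def \<epsilon>_def by blast+
  have int: "integrable M (\<epsilon> t)" for t
    unfolding \<epsilon>_def using int_y by (intro Bochner_Integration.integrable_diff) auto
  have "integrable M (\<lambda>\<omega>. \<epsilon> s \<omega> * \<epsilon> t \<omega>) \<and>
        expectation (\<lambda>\<omega>. \<epsilon> s \<omega> * \<epsilon> t \<omega>) = (if s = t then \<sigma>\<^sup>2 else 0)" for s t
  proof (cases "s = t")
    case True
    have "(\<lambda>\<omega>. (\<epsilon> t \<omega>)\<^sup>2) = (\<lambda>\<omega>. (y \<omega> $ t)\<^sup>2 + (- 2 * expectation (\<lambda>\<omega>. y \<omega> $ t)) * y \<omega> $ t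
        + (expectation (\<lambda>\<omega>. y \<omega> $ t))\<^sup>2)"
      by (simp add: \<epsilon>_def power2_eq_square algebra_simps)
    then have "integrable M (\<lambda>\<omega>. (\<epsilon> t \<omega>)\<^sup>2)"
      using int_y int_y2 by simp
    moreover have "expectation (\<lambda>\<omega>. (\<epsilon> t \<omega>)\<^sup>2) = \<sigma>\<^sup>2"
      using var[of t] by (simp add: mean)
    ultimately show ?thesis using True by (simp add: power2_eq_square)
  next
    case False
    have "indep_vars (\<lambda>_. borel) \<epsilon> {s, t}"
      using indep by (rule indep_vars_subset) auto
    from indep_vars_lebesgue_integral[OF _ this int] indep_vars_integrable[OF _ this int] False
    show ?thesis by (simp add: mean)
  qed
  then have int2: "integrable M (\<lambda>\<omega>. \<epsilon> s \<omega> * \<epsilon> t \<omega>)"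
    and cov: "expectation (\<lambda>\<omega>. \<epsilon> s \<omega> * \<epsilon> t \<omega>) = (if s = t then \<sigma>\<^sup>2 else 0)" for s t
    by auto
  have "expectation (\<lambda>\<omega>. c + a \<bullet> y \<omega>) = c + (\<Sum>t\<in>UNIV. a $ t * expectation (\<lambda>\<omega>. y \<omega> $ t))"
    using int_y by (simp add: inner_vec_def prob_space)
  then have "c + a \<bullet> y \<omega> - expectation (\<lambda>\<omega>. c + a \<bullet> y \<omega>) = (\<Sum>t\<in>UNIV. a $ t * \<epsilon> t \<omega>)" for \<omega>
    by (simp add: inner_vec_def \<epsilon>_def right_diff_distrib sum_subtractf)
  then have "forecast_variance M y (\<lambda>v. c + a \<bullet> v) = expectation (\<lambda>\<omega>. (\<Sum>t\<in>UNIV. a $ t * \<epsilon> t \<omega>)\<^sup>2)"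
    by (simp add: forecast_variance_def)
  also have "\<dots> = expectation (\<lambda>\<omega>. \<Sum>s\<in>UNIV. \<Sum>t\<in>UNIV. (a $ s * a $ t) * (\<epsilon> s \<omega> * \<epsilon> t \<omega>))"
    by (simp add: power2_eq_square sum_product ac_simps)
  also have "\<dots> = (\<Sum>s\<in>UNIV. \<Sum>t\<in>UNIV. (a $ s * a $ t) * (if s = t then \<sigma>\<^sup>2 else 0))"
    using int2 by (simp add: cov)
  also have "\<dots> = \<sigma>\<^sup>2 * (a \<bullet> a)"
    by (simp add: inner_vec_def sum_distrib_left if_distrib[of "\<lambda>x. _ * x"] mult.commute cong: if_cong)
  finally show ?thesis .
qed

section \<open>Least squares as a linear map\<close>

definition gram_inv :: "real ^ 's ^ 't \<Rightarrow> real ^ 's ^ 's" where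
  "gram_inv G = matrix_inv (transpose G ** G)"

text \<open>The vector representing the linear form \<open>v \<mapsto> g \<bullet> w\<close>, where \<open>w\<close> are the unconstrained least
  squares coefficients of the data \<open>v\<close>; see \<open>inner_ls_coefficients\<close>.\<close>

definition dual_vector :: "real ^ 's ^ 't \<Rightarrow> real ^ 's \<Rightarrow> real ^ 't" where
  "dual_vector G g = G *v (gram_inv G *v g)"

text \<open>Products with a transpose are kept as such, since the normal equations are read as matrix
  equations; this simplification rule would turn them into products with a row vector.\<close>

declare transpose_matrix_vector [simp del]

lemma matrix_inner_transpose:
  fixes A :: "real ^ 's ^ 't"
  shows "(A *v w) \<bullet> v = w \<bullet> (transpose A *v v)"
  by (metis dot_lmul_matrix inner_commute vector_transpose_matrix)

text \<open>This equation, which says \<open>transpose G *v dual_vector G g = g\<close>, is the source of all the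
  orthogonality relations below. The Gram matrix is invertible since \<open>G *v w\<close> has length 0 whenever
  the Gram matrix maps \<open>w\<close> to 0.\<close>

lemma inner_dual_vector:
  fixes G :: "real ^ 's::finite ^ 't::finite"
  assumes "rank G = CARD('s)"
  shows "(G *v w) \<bullet> dual_vector G g = w \<bullet> g"
proof -
  let ?A = "transpose G ** G"
  have "inj ((*v) G)" using assms by (simp add: full_rank_injective)
  have "w = 0" if "?A *v w = 0" for w
  proof -
    have "(G *v w) \<bullet> (G *v w) = w \<bullet> (?A *v w)"
      by (simp add: matrix_inner_transpose matrix_vector_mul_assoc)
    with that have "G *v w = G *v 0" by simp
    with \<open>inj ((*v) G)\<close> show ?thesis by (rule injD)
  qed
  then have "invertible ?A"
    by (simp add: invertible_left_inverse matrix_left_invertible_ker)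
  then have "?A ** gram_inv G = mat 1"
    unfolding gram_inv_def matrix_inv_def invertible_def
    by (rule someI2_ex) simp
  then have "transpose G *v dual_vector G g = g"
    by (simp add: dual_vector_def matrix_vector_mul_assoc matrix_mul_assoc)
  then show ?thesis
    by (simp add: matrix_inner_transpose)
qed

lemma inner_dual_vectors:
  fixes G :: "real ^ 's::finite ^ 't::finite"
  assumes "rank G = CARD('s)"
  shows "dual_vector G g \<bullet> dual_vector G h = (gram_inv G *v g) \<bullet> h"
  using inner_dual_vector[OF assms, of "gram_inv G *v g" h] by (simp add: dual_vector_def)

lemma inner_ls_coefficients:
  fixes G :: "real ^ 's::finite ^ 't::finite"
  assumes "rank G = CARD('s)"
  shows "g \<bullet> (gram_inv G *v (transpose G *v v)) = dual_vector G g \<bullet> v"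
proof -
  let ?h = "transpose G *v v"
  \<comment> \<open>\<open>gram_inv G\<close> is symmetric, because it is the matrix of inner products of dual vectors\<close>
  have "(gram_inv G *v ?h) \<bullet> g = (gram_inv G *v g) \<bullet> ?h"
    by (metis inner_commute inner_dual_vectors[OF assms])
  then have "g \<bullet> (gram_inv G *v ?h) = (gram_inv G *v g) \<bullet> ?h"
    by (simp only: inner_commute)
  then show ?thesis
    by (simp add: dual_vector_def matrix_inner_transpose)
qed

lemma norm_diff_square_orthogonal:
  fixes p q :: "'a::real_inner"
  assumes "p \<bullet> q = 0"
  shows "(norm (p - q))\<^sup>2 = (norm p)\<^sup>2 + (norm q)\<^sup>2"
  using assms
  by (simp add: power2_norm_eq_inner inner_diff_left inner_diff_right inner_commute)

text \<open>By Pythagoras a feasible point whose residual is orthogonal to all feasible directions is the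
  minimizer, and injectivity of \<open>F\<close> makes it the only one.\<close>

lemma ls_weights_eqI:
  fixes F :: "real ^ 's::finite ^ 't::finite"
  assumes rank: "rank F = CARD('s)" and feasible: "w0 \<in> weight_space X"
    and orth: "\<And>w. w \<in> weight_space X \<Longrightarrow> (F *v (w - w0)) \<bullet> (v - F *v w0) = 0"
  shows "ls_weights X F v = w0"
proof -
  have pyth: "(norm (v - F *v w))\<^sup>2 = (norm (v - F *v w0))\<^sup>2 + (norm (F *v (w - w0)))\<^sup>2"
    if "w \<in> weight_space X" for w
  proof -
    have "v - F *v w = (v - F *v w0) - F *v (w - w0)"
      by (simp add: matrix_vector_mult_diff_distrib)
    then have "norm (v - F *v w) = norm ((v - F *v w0) - F *v (w - w0))"
      by (rule arg_cong)
    also have "(\<dots>)\<^sup>2 = (norm (v - F *v w0))\<^sup>2 + (norm (F *v (w - w0)))\<^sup>2"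
      using orth[OF that] by (intro norm_diff_square_orthogonal) (simp only: inner_commute)
    finally show ?thesis .
  qed
  show ?thesis
    unfolding ls_weights_def arg_min_on_def
  proof (rule arg_minI[where x = w0 and Q = "\<lambda>w. w = w0"])
    show "w0 \<in> weight_space X" by (fact feasible)
    show "\<not> (norm (v - F *v w))\<^sup>2 < (norm (v - F *v w0))\<^sup>2" if "w \<in> weight_space X" for w
      using pyth[OF that] by simp
    fix w assume w: "w \<in> weight_space X"
      and "\<forall>u. u \<in> weight_space X \<longrightarrow> \<not> (norm (v - F *v u))\<^sup>2 < (norm (v - F *v w))\<^sup>2"
    then have "\<not> (norm (v - F *v w0))\<^sup>2 < (norm (v - F *v w))\<^sup>2"
      using feasible by blast
    with pyth[OF w] have "F *v w = F *v w0"
      by (simp add: matrix_vector_mult_diff_distrib)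
    then show "w = w0"
      using rank unfolding full_rank_injective by (rule injD[rotated])
  qed
qed

lemma ls_residual_orthogonal:
  fixes F :: "real ^ 's::finite ^ 't::finite"
  assumes "rank F = CARD('s)"
  shows "(F *v w) \<bullet> (v - F *v (gram_inv F *v (transpose F *v v))) = 0"
  using inner_dual_vector[OF assms, of w "transpose F *v v"]
  by (simp add: inner_diff_right dual_vector_def matrix_inner_transpose)

lemma ls_weights_unconstrained:
  fixes F :: "real ^ 's::finite ^ 't::finite"
  assumes "rank F = CARD('s)"
  shows "ls_weights KA F v = gram_inv F *v (transpose F *v v)"
  using ls_residual_orthogonal[OF assms] by (intro ls_weights_eqI assms) auto

section \<open>Weights summing to one\<close>

lemma inner_dual_vector_one_pos:
  fixes F :: "real ^ 's::finite ^ 't::finite"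
  assumes "rank F = CARD('s)"
  shows "dual_vector F 1 \<bullet> dual_vector F 1 > 0"
proof -
  have "(1 :: real ^ 's) \<bullet> 1 \<noteq> 0" by (simp add: inner_vec_def)
  then have "dual_vector F 1 \<noteq> 0"
    using inner_dual_vector[OF assms, of 1 1] by auto
  then show ?thesis by simp
qed

text \<open>The constraint changes the weights by a multiple of \<open>gram_inv F *v 1\<close>, because this direction
  is the one whose image under \<open>F\<close> is orthogonal to the images of all \<open>u\<close> with \<open>u \<bullet> 1 = 0\<close>.\<close>

lemma ls_weights_sum_one:
  fixes F :: "real ^ 's::finite ^ 't::finite" and v :: "real ^ 't"
  assumes "rank F = CARD('s)"
  defines "\<rho> \<equiv> (dual_vector F 1 \<bullet> v - 1) / (dual_vector F 1 \<bullet> dual_vector F 1)"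
  shows "ls_weights KB F v = gram_inv F *v (transpose F *v v) - \<rho> *\<^sub>R (gram_inv F *v 1)"
proof (rule ls_weights_eqI[OF assms(1)])
  let ?a = "gram_inv F *v (transpose F *v v)" and ?n = "gram_inv F *v 1"
  let ?w0 = "?a - \<rho> *\<^sub>R ?n"
  have "?n \<bullet> 1 = dual_vector F 1 \<bullet> dual_vector F 1"
    by (simp add: inner_dual_vectors[OF assms(1)])
  moreover have "?a \<bullet> 1 = dual_vector F 1 \<bullet> v"
    using inner_ls_coefficients[OF assms(1), of 1 v] by (simp add: inner_commute)
  ultimately have sum_w0: "?w0 \<bullet> 1 = 1"
    using inner_dual_vector_one_pos[OF assms(1)] by (simp add: inner_diff_left \<rho>_def)
  then show "?w0 \<in> weight_space KB" by simp
  fix w :: "real ^ 's" assume "w \<in> weight_space KB"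
  then have "(w - ?w0) \<bullet> 1 = 0" using sum_w0 by (simp add: inner_diff_left)
  then have "(F *v (w - ?w0)) \<bullet> dual_vector F 1 = 0"
    by (simp only: inner_dual_vector[OF assms(1)])
  moreover have "v - F *v ?w0 = (v - F *v ?a) + \<rho> *\<^sub>R dual_vector F 1"
    by (simp add: dual_vector_def matrix_vector_mult_diff_distrib matrix_vector_mult_scaleR)
  ultimately show "(F *v (w - ?w0)) \<bullet> (v - F *v ?w0) = 0"
    by (simp only: inner_add_right inner_scaleR_right ls_residual_orthogonal[OF assms(1)]
        mult_zero_right add_0)
qed

lemma norm_minus_projection_le:
  fixes a u :: "'a::real_inner"
  shows "(a - ((a \<bullet> u) / (u \<bullet> u)) *\<^sub>R u) \<bullet> (a - ((a \<bullet> u) / (u \<bullet> u)) *\<^sub>R u) \<le> a \<bullet> a"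
proof (cases "u = 0")
  case False
  then have "(a - ((a \<bullet> u) / (u \<bullet> u)) *\<^sub>R u) \<bullet> (a - ((a \<bullet> u) / (u \<bullet> u)) *\<^sub>R u)
      = a \<bullet> a - (a \<bullet> u)\<^sup>2 / (u \<bullet> u)"
    by (simp add: inner_diff_left inner_diff_right inner_commute power2_eq_square)
  then show ?thesis by simp
qed simp

lemma unconstrained_variance:
  fixes F :: "real ^ 's::finite ^ 't::finite"
  assumes "observations M y \<sigma>" and rank: "rank F = CARD('s)"
  shows "forecast_variance M y (\<lambda>v. f \<bullet> ls_weights KA F v)
           = \<sigma>\<^sup>2 * (dual_vector F f \<bullet> dual_vector F f)"
  using forecast_variance_affine[OF assms(1), of 0 "dual_vector F f"]
  by (simp add: ls_weights_unconstrained[OF rank] inner_ls_coefficients[OF rank])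

lemma sum_constrained_variance_le:
  fixes F :: "real ^ 's::finite ^ 't::finite"
  assumes "observations M y \<sigma>" and rank: "rank F = CARD('s)"
  shows "forecast_variance M y (\<lambda>v. f \<bullet> ls_weights KB F v)
           \<le> forecast_variance M y (\<lambda>v. f \<bullet> ls_weights KA F v)"
proof -
  let ?a = "dual_vector F f" and ?u = "dual_vector F 1"
  let ?k = "(?a \<bullet> ?u) / (?u \<bullet> ?u)"
  have "f \<bullet> (gram_inv F *v 1) = ?a \<bullet> ?u"
    using inner_dual_vectors[OF rank, of 1 f] by (simp add: inner_commute)
  then have "(\<lambda>v. f \<bullet> ls_weights KB F v) = (\<lambda>v. ?k + (?a - ?k *\<^sub>R ?u) \<bullet> v)"
    by (simp add: ls_weights_sum_one[OF rank] inner_diff_right inner_diff_left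
        inner_ls_coefficients[OF rank] diff_divide_distrib algebra_simps)
  then have "forecast_variance M y (\<lambda>v. f \<bullet> ls_weights KB F v)
      = \<sigma>\<^sup>2 * ((?a - ?k *\<^sub>R ?u) \<bullet> (?a - ?k *\<^sub>R ?u))"
    by (simp only: forecast_variance_affine[OF assms(1)])
  also have "\<dots> \<le> \<sigma>\<^sup>2 * (?a \<bullet> ?a)"
    by (intro mult_left_mono norm_minus_projection_le) simp
  finally show ?thesis by (simp only: unconstrained_variance[OF assms])
qed

section \<open>Regression with intercept\<close>

definition option_vec :: "real \<Rightarrow> real ^ 's \<Rightarrow> real ^ 's option" where
  "option_vec c w = (\<chi> i. case i of None \<Rightarrow> c | Some s \<Rightarrow> w $ s)"

lemma sum_UNIV_option:
  fixes g :: "'s::finite option \<Rightarrow> real"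
  shows "(\<Sum>i\<in>UNIV. g i) = g None + (\<Sum>s\<in>UNIV. g (Some s))"
  by (simp add: UNIV_option_conv sum.reindex)

lemma inner_option_vec:
  fixes f :: "real ^ 's::finite"
  shows "option_vec c f \<bullet> z = c * z $ None + f \<bullet> (\<chi> s. z $ Some s)"
  by (simp add: option_vec_def inner_vec_def sum_UNIV_option)

lemma with_intercept_mult_option_vec:
  fixes F :: "real ^ 's::finite ^ 't::finite"
  shows "with_intercept F *v option_vec 0 w = F *v w"
  by (simp add: vec_eq_iff matrix_vector_mult_def with_intercept_def option_vec_def sum_UNIV_option)

lemma intercept_forecast_eq:
  fixes F :: "real ^ 's::finite ^ 't::finite"
  assumes "rank (with_intercept F) = CARD('s option)"
  shows "intercept_forecast F f v = dual_vector (with_intercept F) (option_vec 1 f) \<bullet> v"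
proof -
  have "intercept_coeffs F v
      = gram_inv (with_intercept F) *v (transpose (with_intercept F) *v v)"
    by (simp add: intercept_coeffs_def gram_inv_def Let_def)
  then show ?thesis
    unfolding inner_ls_coefficients[OF assms, symmetric]
    by (simp add: intercept_forecast_def inner_option_vec)
qed

text \<open>Both dual vectors solve \<open>transpose F *v a = f\<close>, and the one on the left lies in the range of
  \<open>F\<close>, so it is orthogonal to their difference.\<close>

lemma dual_vector_le_intercept:
  fixes F :: "real ^ 's::finite ^ 't::finite" and f :: "real ^ 's"
  assumes rank: "rank F = CARD('s)" and rank1: "rank (with_intercept F) = CARD('s option)"
  defines "a' \<equiv> dual_vector (with_intercept F) (option_vec 1 f)"
  shows "dual_vector F f \<bullet> dual_vector F f \<le> a' \<bullet> a'"
proof -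
  let ?a = "dual_vector F f"
  have "option_vec 0 w \<bullet> option_vec 1 f = w \<bullet> f" for w
    unfolding inner_option_vec by (simp add: option_vec_def)
  then have "(F *v w) \<bullet> a' = w \<bullet> f" for w
    using inner_dual_vector[OF rank1, of "option_vec 0 w" "option_vec 1 f"]
    by (simp add: a'_def with_intercept_mult_option_vec)
  then have "?a \<bullet> a' = ?a \<bullet> ?a"
    by (metis dual_vector_def inner_dual_vectors[OF rank])
  then have "a' \<bullet> a' = ?a \<bullet> ?a + (a' - ?a) \<bullet> (a' - ?a)"
    by (simp add: inner_diff_left inner_diff_right inner_commute)
  then show ?thesis by simp
qed

lemma intercept_variance_ge:
  fixes F :: "real ^ 's::finite ^ 't::finite"
  assumes "observations M y \<sigma>" "rank F = CARD('s)" "rank (with_intercept F) = CARD('s option)"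
  shows "forecast_variance M y (\<lambda>v. f \<bullet> ls_weights KA F v)
           \<le> forecast_variance M y (intercept_forecast F f)"
proof -
  let ?a' = "dual_vector (with_intercept F) (option_vec 1 f)"
  have "intercept_forecast F f = (\<lambda>v. 0 + ?a' \<bullet> v)"
    by (simp add: fun_eq_iff intercept_forecast_eq[OF assms(3)])
  then have "forecast_variance M y (intercept_forecast F f) = \<sigma>\<^sup>2 * (?a' \<bullet> ?a')"
    by (simp only: forecast_variance_affine[OF assms(1)])
  then show ?thesis
    using dual_vector_le_intercept[OF assms(2,3), of f]
    by (simp add: unconstrained_variance[OF assms(1,2)] mult_left_mono)
qed

section \<open>Comparison and bounds of the forecast variances\<close>

theorem proposition2:
  fixes M :: "'w measure"
    and y :: "'w \<Rightarrow> real ^ 't::finite"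
    and \<sigma> :: real
    and F Fbar :: "real ^ 's::finite ^ 't"
    and f :: "real ^ 's"
    and \<Theta> :: "'s \<Rightarrow> ('p \<times> real) set"
    and lik :: "'s \<Rightarrow> 'p \<times> real \<Rightarrow> real ^ 't \<Rightarrow> real"
  assumes obs: "observations M y \<sigma>"
    and rank_F: "rank F = CARD('s)"
    and rank_F1: "rank (with_intercept F) = CARD('s option)"
    and rank_Fbar: "rank Fbar = CARD('s)"
  shows
    "(forecast_variance M y (intercept_forecast F f) \<ge> forecast_variance M y (\<lambda>v. f \<bullet> ls_weights KA F v) \<and>
      forecast_variance M y (\<lambda>v. f \<bullet> ls_weights KA F v) \<ge> forecast_variance M y (\<lambda>v. f \<bullet> ls_weights KB F v) \<and>
      forecast_variance M y (\<lambda>v. f \<bullet> ls_weights KA Fbar v) \<ge> forecast_variance M y (\<lambda>v. f \<bullet> ls_weights KB Fbar v)) \<and>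
     (forecast_variance M y (\<lambda>v. f \<bullet> ls_weights KC F v) \<le> real CARD('s) * (f \<bullet> f) \<and>
      (\<forall>\<psi>. ma_linear_term M y F \<psi> \<longrightarrow>
         forecast_variance M y (\<lambda>v. f \<bullet> ma_weights KC F \<psi> v) \<le> real CARD('s) * (f \<bullet> f)) \<and>
      forecast_variance M y (\<lambda>v. f \<bullet> ls_weights KC Fbar v) \<le> real CARD('s) * (f \<bullet> f)) \<and>
     (forecast_variance M y (\<lambda>v. f \<bullet> ls_weights KD F v) \<le> f \<bullet> f \<and>
      (\<forall>\<psi>. ma_linear_term M y F \<psi> \<longrightarrow> forecast_variance M y (\<lambda>v. f \<bullet> ma_weights KD F \<psi> v) \<le> f \<bullet> f) \<and>
      forecast_variance M y (\<lambda>v. f \<bullet> ls_weights KD Fbar v) \<le> f \<bullet> f \<and>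
      (\<forall>w. pf_score_weights M y \<Theta> lik w \<or> pf_loss_weights M y w \<longrightarrow>
         forecast_variance M y (\<lambda>v. f \<bullet> w v) \<le> f \<bullet> f)) \<and>
     (\<forall>w. eig_weights M y F w \<longrightarrow> forecast_variance M y (\<lambda>v. f \<bullet> w v) \<le> f \<bullet> f)"
proof -
  have ps: "prob_space M" using obs by (simp add: observations_def)
  have cube: "forecast_variance M y (\<lambda>v. f \<bullet> w v) \<le> real CARD('s) * (f \<bullet> f)"
    if "\<And>v. w v \<in> weight_space KC" for w
    using that by (intro forecast_variance_le_of_weight_bound[OF ps] AE_I2 unit_cube_norm_le)
  have simplex: "forecast_variance M y (\<lambda>v. f \<bullet> w v) \<le> f \<bullet> f"
    if "AE \<omega> in M. w (y \<omega>) \<in> weight_space KD" for w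
  proof -
    have "AE \<omega> in M. w (y \<omega>) \<bullet> w (y \<omega>) \<le> 1"
      using that by eventually_elim (rule simplex_norm_le)
    then show ?thesis
      using forecast_variance_le_of_weight_bound[OF ps, of w y 1 f] by simp
  qed
  have sphere: "forecast_variance M y (\<lambda>v. f \<bullet> w v) \<le> f \<bullet> f" if "eig_weights M y F w" for w
  proof -
    have "AE \<omega> in M. w (y \<omega>) \<bullet> w (y \<omega>) \<le> 1"
      using that by (auto simp: eig_weights_def elim!: eventually_mono)
    then show ?thesis
      using forecast_variance_le_of_weight_bound[OF ps, of w y 1 f] by simp
  qed
  have nonempty: "weight_space KC \<noteq> ({} :: (real ^ 's) set)"
      "weight_space KD \<noteq> ({} :: (real ^ 's) set)"
    using axis_in_simplex unfolding simplex_eq by blast+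
  have ls_C: "ls_weights KC G v \<in> weight_space KC" and ls_D: "ls_weights KD G v \<in> weight_space KD"
    for G :: "real ^ 's ^ 't" and v
    by (intro ls_weights_in_weight_space compact_unit_cube compact_simplex nonempty)+
  have ma_C: "ma_weights KC F \<psi> v \<in> weight_space KC" and ma_D: "ma_weights KD F \<psi> v \<in> weight_space KD"
    for \<psi> v
    by (intro ma_weights_in_weight_space compact_unit_cube compact_simplex nonempty)+
  show ?thesis
    by (intro conjI allI impI intercept_variance_ge[OF obs rank_F rank_F1]
        sum_constrained_variance_le[OF obs rank_F] sum_constrained_variance_le[OF obs rank_Fbar]
        cube[OF ls_C] cube[OF ma_C] simplex[OF AE_I2, OF ls_D] simplex[OF AE_I2, OF ma_D]
        simplex[OF pf_weights_in_simplex] sphere; assumption)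
qed

end
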